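(* Let $\mathcal{B}$ and $\mathcal{C}$ be two barcodes of finite bounded type, and let $\Lambda_{\mathcal{B}}=\{\lambda_i\}_{i=1}^{\infty}$ and $\Lambda_{\mathcal{C}}=\{\mu_j\}_{j=1}^{\infty}$ be their sequences of eigenvalues, arranged so that $\lambda_1\ge\lambda_2\ge\cdots$ and $\mu_1\ge\mu_2\ge\cdots$. Then $$d_{S}^{(1)}(\mathcal{B},\mathcal{C})=\inf_{\sigma}\sum_{i=1}^{\infty}|\lambda_i-\mu_{\sigma(i)}|=\sum_{i=1}^{\infty}|\lambda_i-\mu_i|,$$ where $\sigma$ ranges over all bijections $\mathbb{N}\to\mathbb{N}$.
   Context: A barcode of finite bounded type is a (nonempty) finite multiset $\mathcal{B}=\{I_i\}_{i=1}^{n}$ of bounded intervals $I_i=(a_i,b_i]$ with $a_i<b_i$ real; an interval may appear multiple times. Gram matrix: let $f_i$ be the characteristic function of $I_i=(a_i,b_i]$ on $\mathbb{R}$. The Gram matrix of $\mathcal{B}$ is the $n\times n$ matrix $G_{\mathcal{B}}=(\langle f_i,f_j\rangle)_{i,j=1}^{n}$ with $\langle f_i,f_j\rangle=\int_{\mathbb{R}}\overline{f_j(x)}f_i(x)\,dx=\int_{(a_i,b_i]\cap(a_j,b_j]}1\,dx$. It is positive semi-definite with non-negative entries. Let $\|G_{\mathcal{B}}\|$ be its operator norm, and let $\widetilde{G}_{\mathcal{B}}=\frac{G_{\mathcal{B}}}{\|G_{\mathcal{B}}\|}\oplus\mathbf{0}$, where $\mathbf{0}$ is the zero operator on an infinite-dimensional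 space; so $\widetilde{G}_{\mathcal{B}}$ is the infinite matrix (indexed by $\mathbb{N}=\{1,2,\dots\}$) with upper-left $n\times n$ block $G_{\mathcal{B}}/\|G_{\mathcal{B}}\|$ and all other entries zero. Eigenvalue sequence: $\Lambda_{\mathcal{B}}=\{\lambda_i\}_{i=1}^{\infty}$ denotes the sequence of eigenvalues of $\widetilde{G}_{\mathcal{B}}$ listed with multiplicity, i.e. the $n$ eigenvalues of $G_{\mathcal{B}}/\|G_{\mathcal{B}}\|$ (with multiplicity) together with infinitely many zeros. All are non-negative and only finitely many are nonzero. Pseudo-distance: for barcodes $\mathcal{B},\mathcal{C}$ of finite bounded type with eigenvalue sequences $\{\lambda_i\}$ and $\{\mu_j\}$ (in any order), $d_{S}^{(1)}(\mathcal{B},\mathcal{C})=\inf_{\sigma}\sum_{i=1}^{\infty}|\lambda_i-\mu_{\sigma(i)}|$, where $\sigma$ ranges over all bijections $\sigma:\mathbb{N}\to\mathbb{N}$. *)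

theory Defs
  imports "HOL-Analysis.Analysis" "Jordan_Normal_Form.Char_Poly"
begin

definition barcode :: "real set multiset \<Rightarrow> bool" where
  "barcode B \<longleftrightarrow> B \<noteq> {#} \<and> (\<forall>I\<in>#B. \<exists>a b. a < b \<and> I = {a<..b})"

text \<open>The indexing \<open>I\<^sub>1, \<dots>, I\<^sub>n\<close> of the intervals of a barcode is an arbitrary but fixed one;
  another indexing conjugates the Gram matrix by a permutation matrix.\<close>

definition enumeration :: "'a multiset \<Rightarrow> 'a list" where
  "enumeration B = (SOME Is. mset Is = B)"

text \<open>The characteristic functions are real-valued, so no conjugation is needed.\<close>

definition gram_matrix :: "real set multiset \<Rightarrow> real mat" where
  "gram_matrix B = (let Is = enumeration B in
     mat (size B) (size B)
       (\<lambda>(i, j). LINT x|lborel. indicator (Is ! i) x * indicator (Is ! j) x))"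

text \<open>Operator norm with respect to the Euclidean norm \<open>v \<mapsto> sqrt (v \<bullet> v)\<close>.
  It is only meant for matrices with at least one column.\<close>

definition op_norm :: "real mat \<Rightarrow> real" where
  "op_norm A = (SUP v \<in> {v \<in> carrier_vec (dim_col A). scalar_prod v v = 1}.
     sqrt (scalar_prod (A *\<^sub>v v) (A *\<^sub>v v)))"

definition normalized_gram_matrix :: "real set multiset \<Rightarrow> real mat" where
  "normalized_gram_matrix B = (1 / op_norm (gram_matrix B)) \<cdot>\<^sub>m gram_matrix B"

text \<open>Eigenvalues with algebraic multiplicity. Only real eigenvalues are counted, which is
  harmless for the symmetric matrices considered here.\<close>

definition eigenvalues_mset :: "real mat \<Rightarrow> real multiset" where
  "eigenvalues_mset A = proots (char_poly A)"

text \<open>The sequence \<open>l\<close> lists, in some order, the eigenvalues of the normalized Gram matrix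
  extended by the zero operator on an infinite-dimensional space: the finitely many eigenvalues
  of the finite block, together with infinitely many zeros. Sequences are indexed from 0.\<close>

definition eigenvalue_sequence :: "real set multiset \<Rightarrow> (nat \<Rightarrow> real) \<Rightarrow> bool" where
  "eigenvalue_sequence B l \<longleftrightarrow>
     (\<exists>es p. mset es = eigenvalues_mset (normalized_gram_matrix B) \<and> bij (p :: nat \<Rightarrow> nat) \<and>
        (\<forall>i. l (p i) = (if i < length es then es ! i else 0)))"

text \<open>The two eigenvalue sequences are taken in an arbitrary order. All series involved have only
  finitely many nonzero terms.\<close>

definition dS1 :: "real set multiset \<Rightarrow> real set multiset \<Rightarrow> real" where
  "dS1 B C = (let l = (SOME l. eigenvalue_sequence B l); m = (SOME m. eigenvalue_sequence C m) in
     INF \<sigma> \<in> {\<sigma> :: nat \<Rightarrow> nat. bij \<sigma>}. \<Sum>i. \<bar>l i - m (\<sigma> i)\<bar>)"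

end

theory Submission
  imports Defs
begin

text \<open>Pairing two decreasing sequences in their common order minimises the total distance,
  because uncrossing a pair never hurts: for \<open>a \<ge> a'\<close> and \<open>b \<ge> b'\<close> one has
  \<open>\<bar>a - b\<bar> + \<bar>a' - b'\<bar> \<le> \<bar>a - b'\<bar> + \<bar>a' - b\<bar>\<close>. Starting from any bijection \<open>\<sigma>\<close>, successive swaps
  make \<open>0, 1, 2, \<dots>\<close> fixed points without increasing the cost
  (\<open>bij_improve_fixing_prefix\<close>), so every partial sum of \<open>\<bar>l i - m i\<bar>\<close> is bounded by the cost of
  \<open>\<sigma>\<close>. All the series involved converge because almost all eigenvalues vanish.

  The definition of the pseudo-distance chooses its own orderings of the two spectra. Any two
  orderings of a spectrum differ by a bijection of \<open>\<nat>\<close> (\<open>eigenvalue_sequence_unique\<close>), and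
  composing with bijections on both sides only permutes the set of competing \<open>\<sigma>\<close>
  (\<open>INF_matching_cost_reindex\<close>).\<close>

text \<open>The hypothesis on \<open>c\<close> is the Monge condition. Given a bijection fixing everything below \<open>k\<close>,
  both the image and the preimage \<open>j\<close> of \<open>k\<close> lie weakly beyond \<open>k\<close>, so exchanging the partners of
  \<open>j\<close> and \<open>k\<close> uncrosses them and makes \<open>k\<close> a fixed point. Only two terms of the series change.\<close>

lemma bij_improve_fixing_prefix:
  fixes c :: "nat \<Rightarrow> nat \<Rightarrow> real"
  assumes monge: "\<And>i i' j j'. i \<le> i' \<Longrightarrow> j \<le> j' \<Longrightarrow> c i j + c i' j' \<le> c i j' + c i' j"
    and "bij \<sigma>" and "summable (\<lambda>i. c i (\<sigma> i))"
  shows "\<exists>\<tau>. bij \<tau> \<and> (\<forall>i<k. \<tau> i = i) \<and> summable (\<lambda>i. c i (\<tau> i)) \<and>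
    (\<Sum>i. c i (\<tau> i)) \<le> (\<Sum>i. c i (\<sigma> i))"
proof (induction k)
  case 0
  show ?case using assms(2,3) by auto
next
  case (Suc k)
  then obtain \<tau> where \<tau>: "bij \<tau>" "\<forall>i<k. \<tau> i = i" "summable (\<lambda>i. c i (\<tau> i))"
    "(\<Sum>i. c i (\<tau> i)) \<le> (\<Sum>i. c i (\<sigma> i))" by auto
  obtain j where j: "\<tau> j = k" using \<tau>(1) by (metis bij_pointE)
  have jk: "k \<le> j" using \<tau>(2) j by (metis less_irrefl not_le)
  have k\<tau>: "k \<le> \<tau> k" using \<tau>(1,2) by (metis bij_is_inj injD less_irrefl not_le)
  define \<rho> where "\<rho> = \<tau> \<circ> Transposition.transpose j k"
  have \<rho>: "\<rho> k = k" "\<rho> j = \<tau> k" "\<And>i. i \<noteq> j \<Longrightarrow> i \<noteq> k \<Longrightarrow> \<rho> i = \<tau> i"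
    using j by (auto simp: \<rho>_def)
  have bij: "bij \<rho>" unfolding \<rho>_def using \<tau>(1) by (intro bij_comp) auto
  have fixed: "\<forall>i<Suc k. \<rho> i = i"
    using \<rho> \<tau>(2) jk by (metis less_Suc_eq not_le)
  define d where "d = (\<lambda>i. c i (\<rho> i) - c i (\<tau> i))"
  have d_sums: "d sums (\<Sum>i\<in>{j, k}. d i)"
    by (intro sums_finite) (auto simp: d_def \<rho>)
  have "(\<lambda>i. c i (\<tau> i) + d i) sums ((\<Sum>i. c i (\<tau> i)) + (\<Sum>i\<in>{j, k}. d i))"
    using \<tau>(3) d_sums by (intro sums_add summable_sums)
  hence \<rho>_sums: "(\<lambda>i. c i (\<rho> i)) sums ((\<Sum>i. c i (\<tau> i)) + (\<Sum>i\<in>{j, k}. d i))"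
    by (simp add: d_def)
  have "(\<Sum>i\<in>{j, k}. d i) \<le> 0"
  proof (cases "j = k")
    case True
    then show ?thesis using j \<rho> by (simp add: d_def)
  next
    case False
    then show ?thesis using monge[OF jk k\<tau>] j \<rho> by (simp add: d_def)
  qed
  hence "(\<Sum>i. c i (\<rho> i)) \<le> (\<Sum>i. c i (\<sigma> i))"
    using \<rho>_sums \<tau>(4) by (simp add: sums_iff)
  then show ?case using bij fixed \<rho>_sums by (auto simp: sums_iff)
qed

lemma monotone_matching_optimal:
  fixes l m :: "nat \<Rightarrow> real"
  assumes "decseq l" and "decseq m" and "bij \<sigma>" and "summable (\<lambda>i. \<bar>l i - m (\<sigma> i)\<bar>)"
  shows "(\<Sum>i. \<bar>l i - m i\<bar>) \<le> (\<Sum>i. \<bar>l i - m (\<sigma> i)\<bar>)"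
proof -
  have monge: "\<bar>l i - m j\<bar> + \<bar>l i' - m j'\<bar> \<le> \<bar>l i - m j'\<bar> + \<bar>l i' - m j\<bar>"
    if "i \<le> i'" "j \<le> j'" for i i' j j'
    using decseqD[OF assms(1) that(1)] decseqD[OF assms(2) that(2)] by linarith
  have partial: "(\<Sum>i<k. \<bar>l i - m i\<bar>) \<le> (\<Sum>i. \<bar>l i - m (\<sigma> i)\<bar>)" for k
  proof -
    obtain \<tau> where \<tau>: "\<forall>i<k. \<tau> i = i" "summable (\<lambda>i. \<bar>l i - m (\<tau> i)\<bar>)"
      "(\<Sum>i. \<bar>l i - m (\<tau> i)\<bar>) \<le> (\<Sum>i. \<bar>l i - m (\<sigma> i)\<bar>)"
      using bij_improve_fixing_prefix[where c = "\<lambda>i j. \<bar>l i - m j\<bar>", OF monge assms(3,4)]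
      by blast
    have "(\<Sum>i<k. \<bar>l i - m i\<bar>) = (\<Sum>i<k. \<bar>l i - m (\<tau> i)\<bar>)" using \<tau>(1) by simp
    also have "\<dots> \<le> (\<Sum>i. \<bar>l i - m (\<tau> i)\<bar>)" using \<tau>(2) by (intro sum_le_suminf) auto
    finally show ?thesis using \<tau>(3) by linarith
  qed
  have "summable (\<lambda>i. \<bar>l i - m i\<bar>)"
    using partial by (intro summableI_nonneg_bounded) auto
  then show ?thesis using partial by (intro suminf_le_const)
qed

lemma summable_matching_cost:
  fixes l m :: "nat \<Rightarrow> real"
  assumes "finite {i. l i \<noteq> 0}" and "finite {i. m i \<noteq> 0}" and "bij \<sigma>"
  shows "summable (\<lambda>i. \<bar>l i - m (\<sigma> i)\<bar>)"
proof (rule summable_finite)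
  show "finite ({i. l i \<noteq> 0} \<union> \<sigma> -` {i. m i \<noteq> 0})"
    using assms by (intro finite_UnI finite_vimageI bij_is_inj)
qed auto

text \<open>Substituting \<open>i = \<alpha> k\<close> in the series turns the competitor \<open>\<beta> \<circ> \<sigma> \<circ> inv_into UNIV \<alpha>\<close> for \<open>l, m\<close> into the
  competitor \<open>\<sigma>\<close> for \<open>l \<circ> \<alpha>, m \<circ> \<beta>\<close>.\<close>

lemma INF_matching_cost_reindex:
  fixes l m :: "nat \<Rightarrow> real"
  assumes fin: "finite {i. l i \<noteq> 0}" "finite {i. m i \<noteq> 0}" and \<alpha>: "bij \<alpha>" and \<beta>: "bij \<beta>"
  shows "(INF \<sigma> \<in> {\<sigma> :: nat \<Rightarrow> nat. bij \<sigma>}. \<Sum>i. \<bar>l (\<alpha> i) - m (\<beta> (\<sigma> i))\<bar>) =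
    (INF \<sigma> \<in> {\<sigma> :: nat \<Rightarrow> nat. bij \<sigma>}. \<Sum>i. \<bar>l i - m (\<sigma> i)\<bar>)"
proof -
  let ?S = "{\<sigma> :: nat \<Rightarrow> nat. bij \<sigma>}"
  define T where "T = (\<lambda>\<sigma>. \<beta> \<circ> \<sigma> \<circ> inv_into UNIV \<alpha>)"
  have T_surj: "T ` ?S = ?S"
  proof
    show "T ` ?S \<subseteq> ?S" using \<alpha> \<beta> by (auto simp: T_def intro!: bij_comp bij_imp_bij_inv)
    show "?S \<subseteq> T ` ?S"
    proof
      fix \<sigma> assume "\<sigma> \<in> ?S"
      hence "inv_into UNIV \<beta> \<circ> \<sigma> \<circ> \<alpha> \<in> ?S" using \<alpha> \<beta> by (auto intro!: bij_comp bij_imp_bij_inv)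
      moreover have "\<sigma> = T (inv_into UNIV \<beta> \<circ> \<sigma> \<circ> \<alpha>)"
        using \<alpha> \<beta> by (auto simp: T_def fun_eq_iff bij_is_surj surj_f_inv_f)
      ultimately show "\<sigma> \<in> T ` ?S" by blast
    qed
  qed
  have cost: "(\<Sum>i. \<bar>l (\<alpha> i) - m (\<beta> (\<sigma> i))\<bar>) = (\<Sum>i. \<bar>l i - m (T \<sigma> i)\<bar>)" if "bij \<sigma>" for \<sigma>
  proof -
    have "bij (T \<sigma>)" using T_surj that by auto
    hence "summable (\<lambda>i. \<bar>l i - m (T \<sigma> i)\<bar>)" by (rule summable_matching_cost[OF fin])
    hence "(\<Sum>i. ((\<lambda>i. \<bar>l i - m (T \<sigma> i)\<bar>) \<circ> \<alpha>) i) = (\<Sum>i. \<bar>l i - m (T \<sigma> i)\<bar>)"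
      using \<alpha> by (intro suminf_reindex) (auto simp: bij_is_inj bij_is_surj)
    thus ?thesis using \<alpha> by (simp add: T_def bij_is_inj)
  qed
  have "(\<lambda>\<sigma>. \<Sum>i. \<bar>l (\<alpha> i) - m (\<beta> (\<sigma> i))\<bar>) ` ?S = (\<lambda>\<sigma>. \<Sum>i. \<bar>l i - m (\<sigma> i)\<bar>) ` T ` ?S"
    unfolding image_image by (intro image_cong) (auto simp: cost)
  thus ?thesis by (simp add: T_surj)
qed

lemma finite_support_eigenvalue_sequence:
  assumes "eigenvalue_sequence B l"
  shows "finite {i. l i \<noteq> 0}"
proof -
  obtain es :: "real list" and p :: "nat \<Rightarrow> nat" where p: "bij p"
    and l: "\<And>i. l (p i) = (if i < length es then es ! i else 0)"
    using assms unfolding eigenvalue_sequence_def by blast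
  have "{i. l i \<noteq> 0} \<subseteq> p ` {..<length es}"
  proof
    fix i assume "i \<in> {i. l i \<noteq> 0}"
    moreover obtain k where "i = p k" using p by (metis bij_pointE)
    ultimately show "i \<in> p ` {..<length es}" using l by (auto split: if_splits)
  qed
  thus ?thesis by (rule finite_subset) simp
qed

text \<open>The two lists of eigenvalues are permutations of each other; such a permutation of the
  initial segment, extended by the identity, also matches the padding zeros.\<close>

lemma eigenvalue_sequence_unique:
  assumes "eigenvalue_sequence B l" and "eigenvalue_sequence B l'"
  obtains \<alpha> where "bij \<alpha>" and "\<And>i. l' i = l (\<alpha> i)"
proof -
  obtain es p where es: "mset es = eigenvalues_mset (normalized_gram_matrix B)" and p: "bij p"
    and l: "\<And>i. l (p i) = (if i < length es then es ! i else 0)"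
    using assms(1) unfolding eigenvalue_sequence_def by blast
  obtain es' p' where es': "mset es' = eigenvalues_mset (normalized_gram_matrix B)"
    and p': "bij p'" and l': "\<And>i. l' (p' i) = (if i < length es' then es' ! i else 0)"
    using assms(2) unfolding eigenvalue_sequence_def by blast
  have "mset es' = mset es" using es es' by simp
  then obtain q where q: "q permutes {..<length es}" "permute_list q es = es'"
    by (rule mset_eq_permutation)
  have len: "length es' = length es" using q(2) by auto
  have qlt: "q i < length es \<longleftrightarrow> i < length es" for i
    using permutes_in_image[OF q(1)] by simp
  have eq: "l' (p' i) = l (p (q i))" for i
    using l l' q len qlt by (auto simp: permute_list_nth)
  show thesis
  proof
    show "bij (p \<circ> q \<circ> inv_into UNIV p')"
      using p p' permutes_bij[OF q(1)] by (intro bij_comp bij_imp_bij_inv)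
    show "l' i = l ((p \<circ> q \<circ> inv_into UNIV p') i)" for i
      using eq[of "inv_into UNIV p' i"] p' by (simp add: bij_is_surj surj_f_inv_f)
  qed
qed

theorem proposition3p4:
  fixes B C :: "real set multiset" and l m :: "nat \<Rightarrow> real"
  assumes "barcode B" and "barcode C"
    and "eigenvalue_sequence B l" and "eigenvalue_sequence C m"
    and "decseq l" and "decseq m"
  shows "dS1 B C = (INF \<sigma> \<in> {\<sigma> :: nat \<Rightarrow> nat. bij \<sigma>}. \<Sum>i. \<bar>l i - m (\<sigma> i)\<bar>) \<and>
    (INF \<sigma> \<in> {\<sigma> :: nat \<Rightarrow> nat. bij \<sigma>}. \<Sum>i. \<bar>l i - m (\<sigma> i)\<bar>) = (\<Sum>i. \<bar>l i - m i\<bar>)"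
proof
  note fin = finite_support_eigenvalue_sequence[OF assms(3)]
    finite_support_eigenvalue_sequence[OF assms(4)]
  define l' where "l' = (SOME l. eigenvalue_sequence B l)"
  define m' where "m' = (SOME m. eigenvalue_sequence C m)"
  have "eigenvalue_sequence B l'" unfolding l'_def using assms(3) by (rule someI[where P = "eigenvalue_sequence B"])
  then obtain \<alpha> where \<alpha>: "bij \<alpha>" "\<And>i. l' i = l (\<alpha> i)"
    using eigenvalue_sequence_unique[OF assms(3)] by blast
  have "eigenvalue_sequence C m'" unfolding m'_def using assms(4) by (rule someI[where P = "eigenvalue_sequence C"])
  then obtain \<beta> where \<beta>: "bij \<beta>" "\<And>i. m' i = m (\<beta> i)"
    using eigenvalue_sequence_unique[OF assms(4)] by blast
  have "dS1 B C = (INF \<sigma> \<in> {\<sigma> :: nat \<Rightarrow> nat. bij \<sigma>}. \<Sum>i. \<bar>l' i - m' (\<sigma> i)\<bar>)"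
    by (simp add: dS1_def Let_def l'_def m'_def)
  also have "\<dots> = (INF \<sigma> \<in> {\<sigma> :: nat \<Rightarrow> nat. bij \<sigma>}. \<Sum>i. \<bar>l i - m (\<sigma> i)\<bar>)"
    unfolding \<alpha>(2) \<beta>(2) by (rule INF_matching_cost_reindex[OF fin \<alpha>(1) \<beta>(1)])
  finally show "dS1 B C = (INF \<sigma> \<in> {\<sigma> :: nat \<Rightarrow> nat. bij \<sigma>}. \<Sum>i. \<bar>l i - m (\<sigma> i)\<bar>)" .
  show "(INF \<sigma> \<in> {\<sigma> :: nat \<Rightarrow> nat. bij \<sigma>}. \<Sum>i. \<bar>l i - m (\<sigma> i)\<bar>) = (\<Sum>i. \<bar>l i - m i\<bar>)"
  proof (rule cInf_eq_minimum)
    show "(\<Sum>i. \<bar>l i - m i\<bar>) \<in> (\<lambda>\<sigma>. \<Sum>i. \<bar>l i - m (\<sigma> i)\<bar>) ` {\<sigma>. bij \<sigma>}"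
      by (rule image_eqI[where x = id]) auto
  next
    fix x assume "x \<in> (\<lambda>\<sigma>. \<Sum>i. \<bar>l i - m (\<sigma> i)\<bar>) ` {\<sigma>. bij \<sigma>}"
    then show "(\<Sum>i. \<bar>l i - m i\<bar>) \<le> x"
      using monotone_matching_optimal[OF assms(5,6)] summable_matching_cost[OF fin] by auto
  qed
qed

end
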